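(* Let $n\ge 1$ and let $R\cong(\mathbb{F}_2)^n$. Then $\Gamma'_{Reg}(R)\cong K_1+In(R)$.
   Context: For a commutative von Neumann regular ring $R$ with identity (i.e. for every $x\in R$ there is $y\in R$ with $xyx=x$), $\Gamma'_{Reg}(R)$ is the simple graph with vertex set $R\setminus\{0_R\}$ in which two distinct vertices $a,b$ are adjacent if and only if $aba=a$ or $bab=b$. The inclusion ideal graph $In(R)$ has as vertices all nontrivial ideals of $R$ (ideals different from $\{0_R\}$ and $R$), two distinct vertices $I,J$ being adjacent if and only if $I\subset J$ or $J\subset I$. $G+H$ denotes the join of graphs: the disjoint union of $G$ and $H$ together with all edges between $V(G)$ and $V(H)$. $\mathbb{F}_2$ is the field with two elements. *)

theory Defs
  imports
    "HOL-Algebra.Chinese_Remainder"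
    "HOL-Number_Theory.Residues"
    "Graph_Theory.Pair_Digraph"
    "Graph_Theory.Digraph_Isomorphism"
    "Graph_Theory.Kuratowski"
begin

text \<open>
  A simple graph is represented as a symmetric, loop-free digraph without parallel arcs
  (\<^locale>\<open>pair_bidirected_digraph\<close>): the edge between \<open>u\<close> and \<open>v\<close> is the pair of arcs
  \<open>(u, v)\<close>, \<open>(v, u)\<close>. Unlike \<^locale>\<open>pair_graph\<close>, this does not require finiteness. Isomorphism is
  \<^const>\<open>digraph_iso\<close>, applied through \<^const>\<open>with_proj\<close>.
\<close>

locale von_neumann_regular_cring = cring +
  assumes regular: "x \<in> carrier R \<Longrightarrow> \<exists>y \<in> carrier R. x \<otimes> y \<otimes> x = x"

text \<open>The intended argument of the next definition is a \<^locale>\<open>von_neumann_regular_cring\<close>.\<close>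

definition gamma_reg :: "('a, 'm) ring_scheme \<Rightarrow> 'a pair_pre_digraph" where
  "gamma_reg R =
    \<lparr> pverts = carrier R - {\<zero>\<^bsub>R\<^esub>},
      parcs = {(a, b). a \<in> carrier R - {\<zero>\<^bsub>R\<^esub>} \<and> b \<in> carrier R - {\<zero>\<^bsub>R\<^esub>} \<and> a \<noteq> b \<and>
        (a \<otimes>\<^bsub>R\<^esub> b \<otimes>\<^bsub>R\<^esub> a = a \<or> b \<otimes>\<^bsub>R\<^esub> a \<otimes>\<^bsub>R\<^esub> b = b)} \<rparr>"

definition nontrivial_ideals :: "('a, 'm) ring_scheme \<Rightarrow> 'a set set" where
  "nontrivial_ideals R = {I. ideal I R \<and> I \<noteq> {\<zero>\<^bsub>R\<^esub>} \<and> I \<noteq> carrier R}"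

definition inclusion_ideal_graph :: "('a, 'm) ring_scheme \<Rightarrow> 'a set pair_pre_digraph" where
  "inclusion_ideal_graph R =
    \<lparr> pverts = nontrivial_ideals R,
      parcs = {(I, J). I \<in> nontrivial_ideals R \<and> J \<in> nontrivial_ideals R \<and>
        (I \<subset> J \<or> J \<subset> I)} \<rparr>"

definition K_one :: "unit pair_pre_digraph" where
  "K_one = \<lparr> pverts = {()}, parcs = {} \<rparr>"

definition graph_join ::
    "'a pair_pre_digraph \<Rightarrow> 'b pair_pre_digraph \<Rightarrow> ('a + 'b) pair_pre_digraph" where
  "graph_join G H =
    \<lparr> pverts = pverts G <+> pverts H,
      parcs = map_prod Inl Inl ` parcs G \<union> map_prod Inr Inr ` parcs H
        \<union> Inl ` pverts G \<times> Inr ` pverts H \<union> Inr ` pverts H \<times> Inl ` pverts G \<rparr>"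

lemma complete_digraph_K_one: "K\<^bsub>1\<^esub> (with_proj K_one)"
  by (auto simp: complete_digraph_pair_def K_one_def)

lemma pair_bidirected_digraph_gamma_reg: "pair_bidirected_digraph (gamma_reg R)"
  by unfold_locales (auto simp: gamma_reg_def symmetric_def sym_def)

lemma pair_bidirected_digraph_inclusion_ideal_graph:
  "pair_bidirected_digraph (inclusion_ideal_graph R)"
  by unfold_locales (auto simp: inclusion_ideal_graph_def symmetric_def sym_def)

lemma pair_bidirected_digraph_graph_join:
  assumes "pair_bidirected_digraph G" and "pair_bidirected_digraph H"
  shows "pair_bidirected_digraph (graph_join G H)"
proof -
  interpret G: pair_bidirected_digraph G by fact
  interpret H: pair_bidirected_digraph H by fact
  have "sym (parcs G)" "sym (parcs H)"
    using G.pair_sym_arcs H.pair_sym_arcs by (simp_all add: symmetric_def)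
  then have "sym (parcs (graph_join G H))"
    unfolding graph_join_def sym_def by force
  then show ?thesis
    by unfold_locales
      (auto simp: graph_join_def symmetric_def
        dest: G.wellformed' H.wellformed' G.pair_no_loops H.pair_no_loops)
qed

text \<open>The powers of the two-element field are Boolean rings, hence von Neumann regular.\<close>

lemma F2_power_idem:
  assumes "x \<in> carrier (RDirProd_list (replicate n (residue_ring 2)))"
  shows "x \<otimes>\<^bsub>RDirProd_list (replicate n (residue_ring 2))\<^esub> x = x"
  using assms
proof (induction n arbitrary: x)
  case 0
  then show ?case by (simp add: monoid.defs)
next
  case (Suc n)
  let ?S = "RDirProd_list (replicate n (residue_ring 2))"
  from Suc.prems obtain a as where x: "x = (\<lambda>(a, as). a # as) (a, as)"
    and a: "a \<in> carrier (residue_ring 2)" and as: "as \<in> carrier ?S"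
    by (auto simp: RDirProd_list_carrier)
  have "a = 0 \<or> a = 1" using a by (auto simp: residue_ring_def)
  then have aa: "a \<otimes>\<^bsub>residue_ring 2\<^esub> a = a" by (auto simp: residue_ring_def)
  have c: "(a, as) \<in> carrier (RDirProd (residue_ring 2) ?S)"
    using a as by (simp add: RDirProd_carrier)
  have "(a, as) \<otimes>\<^bsub>RDirProd (residue_ring 2) ?S\<^esub> (a, as) = (a, as)"
    using aa Suc.IH[OF as] by (simp add: RDirProd_def DirProd_def monoid.defs)
  then show ?case
    using ring_hom_mult[OF RDirProd_list_hom1 c c] unfolding x by simp
qed

lemma F2_power_von_neumann_regular:
  assumes "cring R" and "R \<simeq> RDirProd_list (replicate n (residue_ring 2))"
  shows "von_neumann_regular_cring R"
proof -
  interpret cring R by fact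
  let ?S = "RDirProd_list (replicate n (residue_ring 2))"
  obtain h where h: "h \<in> ring_iso R ?S"
    using assms(2) by (auto simp: is_ring_iso_def)
  note E = ring_iso_memE[OF h]
  have "x \<otimes>\<^bsub>R\<^esub> x = x" if x: "x \<in> carrier R" for x
  proof -
    have "h (x \<otimes>\<^bsub>R\<^esub> x) = h x"
      using E(1)[OF x] E(2)[OF x x] F2_power_idem by simp
    then show ?thesis
      using E(5) x by (meson bij_betw_def inj_onD m_closed)
  qed
  then show ?thesis by unfold_locales metis
qed

end

(* In a finite Boolean ring every ideal has the form aR for a unique a, and ab = a holds
   exactly when aR is contained in bR. So a -> aR identifies the graph on the nonzero elements with
   the comparability graph of the nonzero ideals; the ideal R, generated by 1, is comparable to all
   others and is the cone point of the join. *)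

theory Submission
  imports Defs
begin

text \<open>Arcs are pairs of vertices, so a vertex map \<open>h\<close> determines the arc map
  \<open>map_prod h h\<close>. Preserving and reflecting adjacency then amounts to mapping the arc
  set of \<open>G\<close> onto that of \<open>H\<close>.\<close>

lemma digraph_iso_with_projI:
  assumes "pair_bidirected_digraph G" and "pair_bidirected_digraph H"
    and bij: "bij_betw h (pverts G) (pverts H)"
    and arcs: "\<And>u v. \<lbrakk>u \<in> pverts G; v \<in> pverts G\<rbrakk>
      \<Longrightarrow> (h u, h v) \<in> parcs H \<longleftrightarrow> (u, v) \<in> parcs G"
  shows "digraph_iso (with_proj G) (with_proj H)"
proof -
  interpret G: pair_bidirected_digraph G by fact
  interpret H: pair_bidirected_digraph H by fact
  let ?f = "\<lparr>iso_verts = h, iso_arcs = map_prod h h, iso_head = snd, iso_tail = fst\<rparr>"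
  have inj: "inj_on h (pverts G)" and img: "h ` pverts G = pverts H"
    using bij by (auto simp: bij_betw_def)
  have sub: "parcs G \<subseteq> pverts G \<times> pverts G"
    by (auto dest: G.in_arcsD1 G.in_arcsD2)
  have "inj_on (map_prod h h) (parcs G)"
    using map_prod_inj_on[OF inj inj] sub by (rule inj_on_subset)
  then have "G.digraph_isomorphism ?f"
    using inj G.wf_digraph by (simp add: G.digraph_isomorphism_def)
  moreover have "map_prod h h ` parcs G = parcs H"
  proof (intro equalityI subsetI)
    fix e assume "e \<in> map_prod h h ` parcs G"
    then show "e \<in> parcs H" using arcs sub by auto
  next
    fix e assume e: "e \<in> parcs H"
    then have "fst e \<in> h ` pverts G" "snd e \<in> h ` pverts G"
      unfolding img by (auto intro: H.arc_fst_in_verts H.arc_snd_in_verts)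
    then obtain u v where uv: "u \<in> pverts G" "v \<in> pverts G" "e = (h u, h v)"
      by (metis imageE prod.collapse)
    with e arcs have "(u, v) \<in> parcs G" by simp
    with uv show "e \<in> map_prod h h ` parcs G" by force
  qed
  ultimately show ?thesis
    unfolding digraph_iso_def
    by (intro exI[of _ ?f]) (simp add: app_iso_def with_proj_def img)
qed

locale boolean_cring = cring +
  assumes idem: "x \<in> carrier R \<Longrightarrow> x \<otimes> x = x"
begin

lemma mult_idem_left: "\<lbrakk>x \<in> carrier R; y \<in> carrier R\<rbrakk> \<Longrightarrow> x \<otimes> (x \<otimes> y) = x \<otimes> y"
  by (metis idem m_assoc)

text \<open>Idempotence makes \<open>a\<close> an identity on its own multiples:
  \<open>r \<otimes> a \<otimes> a = r \<otimes> a\<close>. Conversely,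
  \<open>x = x \<otimes> a\<close> exhibits \<open>x\<close> as a multiple.\<close>

lemma mem_cgenideal_iff:
  assumes "a \<in> carrier R" and "x \<in> carrier R"
  shows "x \<in> PIdl a \<longleftrightarrow> x \<otimes> a = x"
proof
  assume "x \<in> PIdl a"
  then show "x \<otimes> a = x"
    using assms by (auto simp: cgenideal_def m_assoc idem)
next
  assume "x \<otimes> a = x"
  then show "x \<in> PIdl a"
    using assms by (force simp: cgenideal_def)
qed

text \<open>An ideal contains \<open>PIdl a\<close> as soon as it contains \<open>a\<close>, so only
  the generator has to be tested. The condition \<open>a \<otimes> b = a\<close> is the order of the
  Boolean algebra.\<close>

lemma cgenideal_subset_iff:
  assumes "a \<in> carrier R" and "b \<in> carrier R"
  shows "PIdl a \<subseteq> PIdl b \<longleftrightarrow> a \<otimes> b = a"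
  using assms cgenideal_ideal cgenideal_minimal cgenideal_self mem_cgenideal_iff by blast

text \<open>This is antisymmetry of that order: the two inclusions give
  \<open>a = a \<otimes> b = b \<otimes> a = b\<close>.\<close>

lemma inj_on_cgenideal: "inj_on (cgenideal R) (carrier R)"
proof (rule inj_onI)
  fix a b assume "a \<in> carrier R" "b \<in> carrier R" "PIdl a = PIdl b"
  then have "a \<otimes> b = a" "b \<otimes> a = b"
    by (simp_all flip: cgenideal_subset_iff)
  then show "a = b" using \<open>a \<in> carrier R\<close> \<open>b \<in> carrier R\<close> by (simp add: m_comm)
qed

lemma cgenideal_zero: "PIdl \<zero> = {\<zero>}"
  by (force simp: cgenideal_def)

lemma cgenideal_one: "PIdl \<one> = carrier R"
  by (force simp: cgenideal_def)

text \<open>Induction on \<open>F\<close>: a unit \<open>u\<close> for the old elements is replaced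
  by its join with the new element \<open>y\<close>, which stays in \<open>I\<close> and fixes the
  old elements as well as \<open>y\<close>.\<close>

lemma finite_subset_ideal_unit:
  assumes I: "ideal I R" and "finite F" and "F \<subseteq> I"
  shows "\<exists>u \<in> I. \<forall>x \<in> F. x \<otimes> u = x"
  using assms(2,3)
proof (induction F)
  case empty
  then show ?case
    using additive_subgroup.zero_closed[OF ideal.axioms(1)[OF I]] by blast
next
  case (insert y F)
  interpret I: ideal I R by (fact I)
  from insert obtain u where u: "u \<in> I" and uF: "\<And>x. x \<in> F \<Longrightarrow> x \<otimes> u = x" by auto
  have y: "y \<in> I" and F: "F \<subseteq> I" using insert.prems by auto
  \<comment> \<open>The Boolean join of \<open>u\<close> and \<open>y\<close>.\<close>
  let ?v = "u \<oplus> (y \<ominus> u \<otimes> y)"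
  have c: "u \<in> carrier R" "y \<in> carrier R" using u y by (auto intro: I.Icarr)
  \<comment> \<open>If \<open>x \<otimes> u = x\<close>, the bracket cancels and \<open>x\<close>
    remains. For \<open>x = y\<close>, idempotence leaves
    \<open>y \<otimes> u \<oplus> (y \<ominus> y \<otimes> u)\<close>, which is
    \<open>y\<close>.\<close>
  have mult_v: "x \<otimes> ?v = x \<otimes> u \<oplus> (x \<otimes> y \<ominus> x \<otimes> u \<otimes> y)" if "x \<in> carrier R" for x
    using that c by (simp add: r_distr r_minus m_assoc minus_eq)
  have "u \<otimes> y \<in> I" using u c(2) by (rule I.I_r_closed)
  then have "?v \<in> I"
    using u y by (simp add: minus_eq I.a_closed I.a_inv_closed)
  moreover have "x \<otimes> ?v = x" if "x \<in> F" for x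
    using mult_v[of x] uF[OF that] that F c I.Icarr by (auto simp: minus_eq r_neg)
  moreover have "y \<otimes> u \<otimes> y = y \<otimes> u"
    using c by (metis idem m_assoc m_comm)
  then have "y \<otimes> ?v = y"
    using mult_v[OF c(2)] c idem[OF c(2)] by (simp add: minus_eq) algebra
  ultimately show ?case by (intro bexI[of _ ?v]) auto
qed

text \<open>The whole ideal serves as the finite set in \<open>finite_subset_ideal_unit\<close>. Its
  unit \<open>a\<close> satisfies \<open>x = x \<otimes> a\<close> for every \<open>x\<close> in
  \<open>I\<close>, hence generates \<open>I\<close>.\<close>

lemma finite_ideal_principal:
  assumes I: "ideal I R" and "finite I"
  shows "\<exists>a \<in> carrier R. I = PIdl a"
proof -
  interpret I: ideal I R by (fact I)
  obtain a where a: "a \<in> I" and unit: "\<And>x. x \<in> I \<Longrightarrow> x \<otimes> a = x"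
    using finite_subset_ideal_unit[OF I \<open>finite I\<close>] by auto
  have "I \<subseteq> PIdl a"
    using a unit by (metis I.Icarr mem_cgenideal_iff subsetI)
  then have "I = PIdl a" using cgenideal_minimal[OF I a] by blast
  then show ?thesis using a by (auto intro: I.Icarr)
qed

lemma bij_betw_cgenideal:
  assumes "finite (carrier R)"
  shows "bij_betw (cgenideal R) (carrier R) {I. ideal I R}"
proof -
  have "finite I" if "ideal I R" for I
    using ideal.Icarr[OF that] assms by (meson finite_subset subsetI)
  then show ?thesis
    unfolding bij_betw_def using inj_on_cgenideal finite_ideal_principal
    by (auto intro: cgenideal_ideal)
qed

text \<open>By commutativity and idempotence \<open>a \<otimes> b \<otimes> a\<close> is
  \<open>a \<otimes> b\<close>, so each regularity condition says that one principal ideal lies in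
  the other. Injectivity of \<open>cgenideal\<close> turns \<open>a \<noteq> b\<close> into
  strictness.\<close>

lemma gamma_reg_arc_iff:
  "(a, b) \<in> parcs (gamma_reg R) \<longleftrightarrow>
    a \<in> carrier R - {\<zero>} \<and> b \<in> carrier R - {\<zero>} \<and> (PIdl a \<subset> PIdl b \<or> PIdl b \<subset> PIdl a)"
proof (cases "a \<in> carrier R \<and> b \<in> carrier R")
  case True
  then have c: "a \<in> carrier R" "b \<in> carrier R" by auto
  have "a \<otimes> b \<otimes> a = a \<otimes> b" "b \<otimes> a \<otimes> b = b \<otimes> a"
    using c by (simp_all add: m_ac idem mult_idem_left)
  moreover have "PIdl a = PIdl b \<longleftrightarrow> a = b"
    using c inj_on_cgenideal by (auto dest: inj_onD)
  ultimately show ?thesis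
    using c by (auto simp: gamma_reg_def psubset_eq cgenideal_subset_iff)
qed (auto simp: gamma_reg_def)

theorem gamma_reg_iso_join:
  assumes fin: "finite (carrier R)" and "\<one> \<noteq> \<zero>"
  shows "digraph_iso (with_proj (gamma_reg R))
    (with_proj (graph_join K_one (inclusion_ideal_graph R)))"
proof -
  \<comment> \<open>\<open>PIdl \<one>\<close> is the whole ring and hence no vertex of the
    inclusion ideal graph, so \<open>\<one>\<close> is sent to the cone point.\<close>
  let ?h = "\<lambda>a. if a = \<one> then Inl () else Inr (PIdl a)"
  let ?H = "graph_join K_one (inclusion_ideal_graph R)"
  have "pair_bidirected_digraph K_one"
    by unfold_locales (auto simp: K_one_def symmetric_def sym_def)
  then have H: "pair_bidirected_digraph ?H"
    using pair_bidirected_digraph_inclusion_ideal_graph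
    by (rule pair_bidirected_digraph_graph_join)
  have bij: "bij_betw (cgenideal R) (carrier R - {\<zero>, \<one>}) (nontrivial_ideals R)"
  proof -
    \<comment> \<open>The two trivial ideals are generated by \<open>\<zero>\<close> and
      \<open>\<one>\<close>, so deleting these from both sides restricts the bijection between
      elements and ideals.\<close>
    have "nontrivial_ideals R = {I. ideal I R} - cgenideal R ` {\<zero>, \<one>}"
      by (auto simp: nontrivial_ideals_def cgenideal_zero cgenideal_one)
    also have "bij_betw (cgenideal R) (carrier R - {\<zero>, \<one>}) \<dots>"
    proof (rule bij_betw_DiffI[OF bij_betw_cgenideal[OF fin]])
      have "{\<zero>, \<one>} \<subseteq> carrier R" by simp
      then show "bij_betw (cgenideal R) {\<zero>, \<one>} (cgenideal R ` {\<zero>, \<one>})"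
        by (intro inj_on_imp_bij_betw inj_on_subset[OF inj_on_cgenideal])
    qed (auto intro: cgenideal_ideal)
    finally show ?thesis .
  qed
  have mem: "PIdl a \<in> nontrivial_ideals R" if "a \<in> carrier R - {\<zero>, \<one>}" for a
    using bij that by (auto dest: bij_betwE)
  have "bij_betw ?h (pverts (gamma_reg R)) (pverts ?H)"
    unfolding bij_betw_def
  proof
    show "inj_on ?h (pverts (gamma_reg R))"
      using inj_on_cgenideal by (auto simp: inj_on_def gamma_reg_def)
    have "pverts (gamma_reg R) = insert \<one> (carrier R - {\<zero>, \<one>})"
      using \<open>\<one> \<noteq> \<zero>\<close> by (auto simp: gamma_reg_def)
    moreover have "?h ` (carrier R - {\<zero>, \<one>}) = Inr ` cgenideal R ` (carrier R - {\<zero>, \<one>})"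
      by (force simp: image_image)
    moreover have "pverts ?H = insert (Inl ()) (Inr ` nontrivial_ideals R)"
      by (auto simp: graph_join_def K_one_def inclusion_ideal_graph_def)
    ultimately show "?h ` pverts (gamma_reg R) = pverts ?H"
      unfolding bij_betw_imp_surj_on[OF bij] by (simp only: image_insert if_True refl)
  qed
  moreover have "(?h a, ?h b) \<in> parcs ?H \<longleftrightarrow> (a, b) \<in> parcs (gamma_reg R)"
    if ab: "a \<in> pverts (gamma_reg R)" "b \<in> pverts (gamma_reg R)" for a b
  proof -
    have c: "a \<in> carrier R - {\<zero>}" "b \<in> carrier R - {\<zero>}"
      using ab by (auto simp: gamma_reg_def)
    \<comment> \<open>These strict inclusions make \<open>\<one>\<close> adjacent to every other
      vertex, matching the edges that the join adds.\<close>
    have "PIdl x \<subset> PIdl \<one>" if "x \<in> carrier R - {\<zero>, \<one>}" for x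
      using mem[OF that] ideal.Icarr unfolding nontrivial_ideals_def
      by (fastforce simp: cgenideal_one)
    then show ?thesis
      using c mem[of a] mem[of b] unfolding gamma_reg_arc_iff
      by (auto simp: graph_join_def K_one_def inclusion_ideal_graph_def map_prod_def image_iff)
  qed
  ultimately show ?thesis
    by (rule digraph_iso_with_projI[OF pair_bidirected_digraph_gamma_reg H])
qed

end

text \<open>Each further factor contributes a Cartesian product, transported to lists by the
  injective cons map.\<close>

lemma card_RDirProd_list_replicate:
  "card (carrier (RDirProd_list (replicate n S))) = card (carrier S) ^ n"
proof (induction n)
  case (Suc n)
  have "inj_on (\<lambda>(x, xs). x # xs) A" for A :: "('a \<times> 'a list) set"
    by (auto simp: inj_on_def)
  then show ?case
    by (simp add: RDirProd_list_carrier card_image card_cartesian_product Suc.IH)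
qed simp

theorem corollary5:
  fixes R :: "('a, 'm) ring_scheme" and n :: nat
  assumes "cring R"
    and "n \<ge> 1"
    and "R \<simeq> RDirProd_list (replicate n (residue_ring 2))"
  shows "digraph_iso (with_proj (gamma_reg R))
    (with_proj (graph_join K_one (inclusion_ideal_graph R)))"
proof -
  interpret cring R by fact
  obtain h where h: "h \<in> ring_iso R (RDirProd_list (replicate n (residue_ring 2)))"
    using assms(3) by (auto simp: is_ring_iso_def)
  note E = ring_iso_memE[OF h]
  interpret boolean_cring R
  \<comment> \<open>Idempotence is pulled back along the injective homomorphism
    \<open>h\<close>.\<close>
  proof unfold_locales
    fix x assume x: "x \<in> carrier R"
    have "h (x \<otimes>\<^bsub>R\<^esub> x) = h x"
      using E(1)[OF x] E(2)[OF x x] F2_power_idem by simp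
    then show "x \<otimes>\<^bsub>R\<^esub> x = x"
      using E(5) x by (meson bij_betw_def inj_onD m_closed)
  qed
  have "card (carrier R) = 2 ^ n"
    using ring_iso_same_card[OF assms(3)] card_RDirProd_list_replicate[of n "residue_ring 2"]
    by (simp add: residue_ring_def)
  \<comment> \<open>Here \<open>n \<ge> 1\<close> enters. As \<open>card\<close> is 0 on infinite
    sets, this bound gives finiteness as well as \<open>\<one> \<noteq> \<zero>\<close>.\<close>
  then have "card (carrier R) > 1"
    using assms(2) one_less_power[of "2::nat" n] by simp
  then have "finite (carrier R)" "carrier R \<noteq> {\<zero>\<^bsub>R\<^esub>}"
    by (auto intro: card_ge_0_finite)
  then show ?thesis
    using gamma_reg_iso_join carrier_one_zero by blast
qed

end
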